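(* Let $X$ be a nonempty set, $d$ a metric on $X$, $\mathcal S\subseteq X\times X$ a reflexive symmetric relation on $X$, and $T:X\to X$ a map. Suppose that (i) $T$ is $(d,\mathcal S;\lambda)$-contractive for some $\lambda\in(0,1)$; (ii) $X$ is $(d,\mathcal S)$-complete and $\mathcal S$ is $d$-almost-selfclosed; (iii) $T$ is $\mathcal S$-increasing and $\mathcal S^\omega$-semi-progressive. Then $T$ is $\mathcal S^\omega$-global strongly Picard (modulo $(d,\mathcal S^\omega)$).
   Context: $\mathrm{Fix}(T)=\{x\in X: Tx=x\}$. $\mathcal S^\omega$ is the reflexive transitive cover of $\mathcal S$: $x\mathcal S^\omega y$ iff there are $k\ge2$ and $z_1,\dots,z_k\in X$ with $z_1=x$, $z_k=y$ and $z_i\mathcal S z_{i+1}$ for $1\le i\le k-1$. $T$ is $(d,\mathcal S;\lambda)$-contractive if $d(Tx,Ty)\le\lambda d(x,y)$ for all $x,y\in X$ with $x\mathcal S y$. A sequence $(z_n)$ in $X$ is $\mathcal S$-ascending if $z_i\mathcal S z_{i+1}$ for every $i$. $X$ is $(d,\mathcal S)$-complete if every $\mathcal S$-ascending $d$-Cauchy sequence in $X$ is $d$-convergent in $X$. $\mathcal S$ is $d$-almost-selfclosed if, whenever $(z_n)$ is $\mathcal S$-ascending and $d$-converges to $z\in X$, there is a subsequence $(w_n)$ of $(z_n)$ with $w_n\mathcal S z$ for all $n$. $T$ is $\mathcal S$-increasing if $x\mathcal S y$ implies $Tx\mathcal S Ty$. Put $X(T,\mathcal S^\omega)=\{x\in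 X: x\mathcal S^\omega Tx\}$; $T$ is $\mathcal S^\omega$-semi-progressive if $X(T,\mathcal S^\omega)\neq\emptyset$. $T$ is $\mathcal S^\omega$-global strongly Picard (modulo $(d,\mathcal S^\omega)$) if: (a) for each $x\in X(T,\mathcal S^\omega)$, the sequence $(T^nx)_{n\ge0}$ is $d$-convergent and its limit belongs to $\mathrm{Fix}(T)$; and (b) for all $z_1,z_2\in\mathrm{Fix}(T)$, $z_1\mathcal S^\omega z_2$ implies $z_1=z_2$. *)

theory Defs
  imports "HOL-Analysis.Analysis"
begin

text \<open>
  The metric space is a carrier set \<open>X\<close> with a distance \<open>d\<close>, as in the locale \<open>Metric_space\<close>.
  Sequences are indexed from 0.
\<close>

definition Fix :: "'a set \<Rightarrow> ('a \<Rightarrow> 'a) \<Rightarrow> 'a set" where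
  "Fix X T = {x \<in> X. T x = x}"

text \<open>
  \<open>chain_cover X S\<close> is the relation \<open>S\<^sup>\<omega>\<close>. For \<open>S\<close> reflexive on \<open>X\<close> it is the reflexive transitive
  closure within \<open>X\<close>, whereas \<^term>\<open>S\<^sup>*\<close> also relates each point outside \<open>X\<close> to itself.
\<close>

definition chain_cover :: "'a set \<Rightarrow> 'a rel \<Rightarrow> 'a rel" where
  "chain_cover X S =
    {(x, y). \<exists>k\<ge>2. \<exists>z :: nat \<Rightarrow> 'a.
       (\<forall>i\<in>{1..k}. z i \<in> X) \<and> z 1 = x \<and> z k = y \<and> (\<forall>i\<in>{1..k - 1}. (z i, z (i + 1)) \<in> S)}"

definition rel_contractive ::
  "'a set \<Rightarrow> ('a \<Rightarrow> 'a \<Rightarrow> real) \<Rightarrow> 'a rel \<Rightarrow> real \<Rightarrow> ('a \<Rightarrow> 'a) \<Rightarrow> bool" where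
  "rel_contractive X d S c T \<longleftrightarrow>
    (\<forall>x\<in>X. \<forall>y\<in>X. (x, y) \<in> S \<longrightarrow> d (T x) (T y) \<le> c * d x y)"

definition rel_ascending :: "'a set \<Rightarrow> 'a rel \<Rightarrow> (nat \<Rightarrow> 'a) \<Rightarrow> bool" where
  "rel_ascending X S z \<longleftrightarrow> range z \<subseteq> X \<and> (\<forall>i. (z i, z (Suc i)) \<in> S)"

abbreviation d_converges :: "'a set \<Rightarrow> ('a \<Rightarrow> 'a \<Rightarrow> real) \<Rightarrow> (nat \<Rightarrow> 'a) \<Rightarrow> 'a \<Rightarrow> bool" where
  "d_converges X d z l \<equiv> limitin (Metric_space.mtopology X d) z l sequentially"

definition rel_complete :: "'a set \<Rightarrow> ('a \<Rightarrow> 'a \<Rightarrow> real) \<Rightarrow> 'a rel \<Rightarrow> bool" where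
  "rel_complete X d S \<longleftrightarrow>
    (\<forall>z. rel_ascending X S z \<and> Metric_space.MCauchy X d z \<longrightarrow> (\<exists>l. d_converges X d z l))"

definition almost_selfclosed :: "'a set \<Rightarrow> ('a \<Rightarrow> 'a \<Rightarrow> real) \<Rightarrow> 'a rel \<Rightarrow> bool" where
  "almost_selfclosed X d S \<longleftrightarrow>
    (\<forall>z l. rel_ascending X S z \<and> d_converges X d z l \<longrightarrow>
       (\<exists>r :: nat \<Rightarrow> nat. strict_mono r \<and> (\<forall>n. ((z \<circ> r) n, l) \<in> S)))"

definition rel_increasing :: "'a set \<Rightarrow> 'a rel \<Rightarrow> ('a \<Rightarrow> 'a) \<Rightarrow> bool" where
  "rel_increasing X S T \<longleftrightarrow> (\<forall>x\<in>X. \<forall>y\<in>X. (x, y) \<in> S \<longrightarrow> (T x, T y) \<in> S)"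

definition progressive_points :: "'a set \<Rightarrow> ('a \<Rightarrow> 'a) \<Rightarrow> 'a rel \<Rightarrow> 'a set" where
  "progressive_points X T R = {x \<in> X. (x, T x) \<in> R}"

definition semi_progressive :: "'a set \<Rightarrow> 'a rel \<Rightarrow> ('a \<Rightarrow> 'a) \<Rightarrow> bool" where
  "semi_progressive X R T \<longleftrightarrow> progressive_points X T R \<noteq> {}"

definition global_strongly_Picard ::
  "'a set \<Rightarrow> ('a \<Rightarrow> 'a \<Rightarrow> real) \<Rightarrow> 'a rel \<Rightarrow> ('a \<Rightarrow> 'a) \<Rightarrow> bool" where
  "global_strongly_Picard X d R T \<longleftrightarrow>
    (\<forall>x\<in>progressive_points X T R. \<exists>l. d_converges X d (\<lambda>n. (T ^^ n) x) l \<and> l \<in> Fix X T) \<and>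
    (\<forall>z1\<in>Fix X T. \<forall>z2\<in>Fix X T. (z1, z2) \<in> R \<longrightarrow> z1 = z2)"

end

theory Submission
  imports Defs
begin

text \<open>
  Let \<open>x\<close> be related to \<open>T x\<close> by a chain of \<open>p\<close> links. Following this chain, then its image under
  \<open>T\<close>, then its image under \<open>T\<^sup>2\<close>, and so on gives one infinite sequence \<open>y\<close>: each chain
  ends where the next begins. The sequence \<open>y\<close> is ascending because \<open>T\<close> is increasing, it contains the
  orbit of \<open>x\<close> as the terms \<open>y (n * p)\<close>, and it satisfies \<open>y (j + p) = T (y j)\<close>: shifting by \<open>p\<close> is
  applying \<open>T\<close> (lemma \<open>chain_unrolling\<close>).

  Two consequences follow from this shift law. The step lengths of \<open>y\<close> shrink by the factor \<open>c\<close> under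
  every shift by \<open>p\<close>, so they are summable and \<open>y\<close> is Cauchy; completeness yields a limit \<open>l\<close>. Moreover
  a subsequence of \<open>y\<close> is related to \<open>l\<close>, so that the contraction inequality applies to its terms
  paired with \<open>l\<close>, and the images of these terms tend to \<open>T l\<close>. But these images are again terms
  of \<open>y\<close>, hence tend to \<open>l\<close>, and \<open>T l = l\<close> (lemma \<open>shift_orbit_limit_fixed\<close>).

  For uniqueness, the \<open>n\<close>-th image of a chain between two fixed points again joins these points, while
  its total length is at most \<open>c ^ n\<close> times the original one.
\<close>

section \<open>Chains\<close>

text \<open>
  Counting links from 0 instead of vertices from 1 makes the position in an unrolled chain a plain
  quotient with remainder.
\<close>

lemma chain_cover_obtain_links:
  assumes "(x, y) \<in> chain_cover X S"
  obtains p z where "p > 0" "\<And>i. i \<le> p \<Longrightarrow> z i \<in> X" "z 0 = x" "z p = y"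
    "\<And>i. i < p \<Longrightarrow> (z i, z (Suc i)) \<in> S"
proof -
  from assms obtain k :: nat and z where k: "k \<ge> 2" and z: "\<forall>i\<in>{1..k}. z i \<in> X" "z 1 = x" "z k = y"
      "\<forall>i\<in>{1..k - 1}. (z i, z (i + 1)) \<in> S"
    unfolding chain_cover_def by blast
  show thesis
  proof (rule that[of "k - 1" "\<lambda>i. z (Suc i)"])
    fix i assume "i < k - 1"
    hence "Suc i \<in> {1..k - 1}" by auto
    thus "(z (Suc i), z (Suc (Suc i))) \<in> S" using z(4) by fastforce
  qed (use k z in auto)
qed

lemma funpow_in_set:
  assumes "T \<in> X \<rightarrow> X" "u \<in> X"
  shows "(T ^^ n) u \<in> X"
  by (induction n) (use assms in auto)

lemma funpow_rel_increasing:
  assumes "T \<in> X \<rightarrow> X" "rel_increasing X S T" "u \<in> X" "v \<in> X" "(u, v) \<in> S"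
  shows "((T ^^ n) u, (T ^^ n) v) \<in> S"
proof (induction n)
  case (Suc n)
  thus ?case
    using assms funpow_in_set[OF assms(1)] by (auto simp: rel_increasing_def)
qed (use assms in auto)

lemma funpow_rel_contractive:
  assumes "T \<in> X \<rightarrow> X" "rel_increasing X S T" "rel_contractive X d S c T" "0 \<le> c"
    and "u \<in> X" "v \<in> X" "(u, v) \<in> S"
  shows "d ((T ^^ n) u) ((T ^^ n) v) \<le> c ^ n * d u v"
proof (induction n)
  case (Suc n)
  have "d ((T ^^ Suc n) u) ((T ^^ Suc n) v) \<le> c * d ((T ^^ n) u) ((T ^^ n) v)"
    using assms funpow_in_set[OF assms(1)] funpow_rel_increasing[OF assms(1,2)]
    by (simp add: rel_contractive_def)
  also have "\<dots> \<le> c * (c ^ n * d u v)"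
    by (intro mult_left_mono Suc assms)
  finally show ?case by (simp add: mult_ac)
qed simp

text \<open>
  The sequence is \<open>y j = T\<^sup>q (z i)\<close> where \<open>q\<close> and \<open>i\<close> are quotient and remainder of \<open>j\<close> by \<open>p\<close>. At the
  junctions the copies fit together because \<open>z p = T (z 0)\<close>.
\<close>

lemma chain_unrolling:
  assumes T: "T \<in> X \<rightarrow> X" and inc: "rel_increasing X S T" and x: "(x, T x) \<in> chain_cover X S"
  obtains p y where "p > 0" "rel_ascending X S y" "\<And>j. y (j + p) = T (y j)"
    "\<And>n. y (n * p) = (T ^^ n) x"
proof -
  obtain p z where p: "p > 0" and zX: "\<And>i. i \<le> p \<Longrightarrow> z i \<in> X" and z0: "z 0 = x"
    and zp: "z p = T x" and zS: "\<And>i. i < p \<Longrightarrow> (z i, z (Suc i)) \<in> S"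
    using chain_cover_obtain_links[OF x] by metis
  define y where "y = (\<lambda>j. (T ^^ (j div p)) (z (j mod p)))"
  have y_Suc: "y (Suc j) = (T ^^ (j div p)) (z (Suc (j mod p)))" for j
  proof (cases "Suc (j mod p) = p")
    case True
    hence "Suc j mod p = 0" "Suc j div p = Suc (j div p)"
      by (simp_all add: mod_Suc div_Suc)
    thus ?thesis using True z0 zp by (simp add: y_def funpow_swap1)
  next
    case False
    thus ?thesis by (simp add: y_def mod_Suc div_Suc)
  qed
  show thesis
  proof (rule that[OF p])
    show "rel_ascending X S y"
      unfolding rel_ascending_def
    proof (intro conjI allI)
      show "range y \<subseteq> X"
        using p zX funpow_in_set[OF T] by (auto simp: y_def less_imp_le)
      show "(y j, y (Suc j)) \<in> S" for j
        unfolding y_Suc using p zX zS funpow_rel_increasing[OF T inc]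
        by (simp add: y_def less_imp_le Suc_leI)
    qed
  qed (use p z0 in \<open>simp_all add: y_def\<close>)
qed

section \<open>Convergence of sequences on which a shift contracts\<close>

text \<open>
  With \<open>A\<close> the sum of the first \<open>p\<close> terms, splitting off these terms bounds a partial sum \<open>s\<close> by
  \<open>A + c * s\<close>, hence by \<open>A / (1 - c)\<close>.
\<close>

lemma summable_shift_contraction:
  fixes a :: "nat \<Rightarrow> real"
  assumes nonneg: "\<And>j. a j \<ge> 0" and c: "c < 1" and shift: "\<And>j. a (j + p) \<le> c * a j"
  shows "summable a"
proof (rule summableI_nonneg_bounded[OF nonneg])
  fix n
  have "sum a {..<n} \<le> sum a {..<p + n}"
    by (intro sum_mono2) (use nonneg in auto)
  also have "\<dots> = sum a {..<p} + (\<Sum>j<n. a (j + p))"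
    by (induction n) (simp_all add: add_ac)
  also have "(\<Sum>j<n. a (j + p)) \<le> c * sum a {..<n}"
    unfolding sum_distrib_left by (intro sum_mono shift)
  finally have "sum a {..<n} \<le> sum a {..<p} + c * sum a {..<n}" by simp
  thus "sum a {..<n} \<le> sum a {..<p} / (1 - c)"
    using c by (simp add: field_simps)
qed

lemma (in Metric_space) dist_le_sum_steps:
  assumes "m \<le> n" "\<And>i. \<lbrakk>m \<le> i; i \<le> n\<rbrakk> \<Longrightarrow> y i \<in> M"
  shows "d (y m) (y n) \<le> (\<Sum>i=m..<n. d (y i) (y (Suc i)))"
  using assms
proof (induction n rule: dec_induct)
  case (step n)
  have "d (y m) (y (Suc n)) \<le> d (y m) (y n) + d (y n) (y (Suc n))"
    by (intro triangle step.prems) (use step.hyps in auto)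
  also have "d (y m) (y n) \<le> (\<Sum>i=m..<n. d (y i) (y (Suc i)))"
    by (intro step.IH step.prems) auto
  finally show ?case using step.hyps by simp
qed simp

lemma (in Metric_space) MCauchy_if_summable_steps:
  assumes y: "range y \<subseteq> M" and summ: "summable (\<lambda>i. d (y i) (y (Suc i)))"
  shows "MCauchy y"
  unfolding MCauchy_def
proof (intro conjI allI impI y)
  fix e :: real assume "e > 0"
  then obtain N where N: "\<And>m n. m \<ge> N \<Longrightarrow> norm (\<Sum>i=m..<n. d (y i) (y (Suc i))) < e"
    using summ unfolding summable_Cauchy by meson
  have le: "d (y m) (y n) < e" if "N \<le> m" "m \<le> n" for m n
    using dist_le_sum_steps[OF that(2), of y] N[OF that(1), of n] y by force
  show "\<exists>N. \<forall>n n'. N \<le> n \<longrightarrow> N \<le> n' \<longrightarrow> d (y n) (y n') < e"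
    using le commute nle_le by metis
qed

text \<open>
  The contraction inequality is available only for related points, so it yields \<open>T (y j) \<rightarrow> T l\<close> only
  along the subsequence that almost-selfclosedness provides. This suffices, as the shift law
  turns that sequence of images into a subsequence of \<open>y\<close>.
\<close>

lemma (in Metric_space) shift_orbit_limit_fixed:
  assumes T: "T \<in> M \<rightarrow> M" and contr: "rel_contractive M d S c T" and c: "c < 1"
    and compl: "rel_complete M d S" and closed: "almost_selfclosed M d S"
    and asc: "rel_ascending M S y" and shift: "\<And>j. y (j + p) = T (y j)"
  obtains l where "limitin mtopology y l sequentially" "l \<in> Fix M T"
proof -
  have yM: "range y \<subseteq> M" and yS: "\<And>j. (y j, y (Suc j)) \<in> S"
    using asc by (auto simp: rel_ascending_def)
  have "summable (\<lambda>j. d (y j) (y (Suc j)))"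
  proof (rule summable_shift_contraction[OF nonneg c])
    show "d (y (j + p)) (y (Suc (j + p))) \<le> c * d (y j) (y (Suc j))" for j
      using contr yM yS[of j] shift[of j] shift[of "Suc j"]
      by (simp add: rel_contractive_def image_subset_iff)
  qed
  then obtain l where l: "limitin mtopology y l sequentially"
    using compl asc MCauchy_if_summable_steps[OF yM] unfolding rel_complete_def by blast
  then have lM: "l \<in> M" by (simp add: limitin_mspace)
  hence TlM: "T l \<in> M" using T by auto
  obtain r :: "nat \<Rightarrow> nat" where r: "strict_mono r" "\<And>n. (y (r n), l) \<in> S"
    using closed asc l unfolding almost_selfclosed_def by fastforce
  let ?w = "\<lambda>n. y (r n + p)"
  have w_l: "limitin mtopology ?w l sequentially"
    using limitin_subsequence[OF _ l, of "\<lambda>n. r n + p"] r(1)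
    by (simp add: o_def strict_mono_def)
  have "(\<lambda>n. d (y (r n)) l) \<longlonglongrightarrow> 0"
    using limitin_subsequence[OF r(1) l] by (simp add: limitin_metric_dist_null o_def)
  hence lim0: "(\<lambda>n. c * d (y (r n)) l) \<longlonglongrightarrow> 0"
    by (rule tendsto_mult_right_zero)
  have "d (?w n) (T l) \<le> c * d (y (r n)) l" for n
    using contr r(2) yM lM by (simp add: rel_contractive_def shift image_subset_iff)
  hence "(\<lambda>n. d (?w n) (T l)) \<longlonglongrightarrow> 0"
    by (intro tendsto_sandwich[OF _ _ tendsto_const lim0] always_eventually allI nonneg)
  hence "limitin mtopology ?w (T l) sequentially"
    using yM TlM by (simp add: limitin_metric_dist_null image_subset_iff)
  hence "T l = l"
    using w_l limitin_metric_unique by (metis trivial_limit_sequentially)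
  thus thesis using that l lM by (simp add: Fix_def)
qed

section \<open>The fixed point theorem\<close>

text \<open>
  Applying \<open>T\<^sup>n\<close> to a chain keeps its fixed end points and multiplies its length by at most \<open>c ^ n\<close>;
  so the distance of the end points is below every positive bound.
\<close>

lemma (in Metric_space) chain_connected_fixpoints_eq:
  assumes T: "T \<in> M \<rightarrow> M" and inc: "rel_increasing M S T" and contr: "rel_contractive M d S c T"
    and c: "0 \<le> c" "c < 1"
    and fix1: "u \<in> Fix M T" and fix2: "v \<in> Fix M T" and chain: "(u, v) \<in> chain_cover M S"
  shows "u = v"
proof -
  obtain p z where zM: "\<And>i. i \<le> p \<Longrightarrow> z i \<in> M" and z: "z 0 = u" "z p = v"
    and zS: "\<And>i. i < p \<Longrightarrow> (z i, z (Suc i)) \<in> S"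
    using chain_cover_obtain_links[OF chain] by metis
  have iter: "(T ^^ n) u = u" "(T ^^ n) v = v" for n
    using fix1 fix2 by (induction n) (auto simp: Fix_def)
  let ?L = "\<Sum>i<p. d (z i) (z (Suc i))"
  have bound: "d u v \<le> c ^ n * ?L" for n
  proof -
    have "d u v \<le> (\<Sum>i<p. d ((T ^^ n) (z i)) ((T ^^ n) (z (Suc i))))"
      using dist_le_sum_steps[of 0 p "\<lambda>i. (T ^^ n) (z i)"] funpow_in_set[OF T] zM z iter
      by (simp add: atLeast0LessThan)
    also have "\<dots> \<le> c ^ n * ?L"
      unfolding sum_distrib_left
      by (intro sum_mono funpow_rel_contractive[OF T inc contr c(1)]) (use zM zS in auto)
    finally show ?thesis .
  qed
  have "(\<lambda>n. c ^ n * ?L) \<longlonglongrightarrow> 0"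
    using c by (intro tendsto_mult_left_zero LIMSEQ_power_zero) auto
  hence "d u v \<le> 0"
    by (rule LIMSEQ_le_const) (use bound in blast)
  moreover have "u \<in> M" "v \<in> M" using fix1 fix2 by (auto simp: Fix_def)
  ultimately show ?thesis using zero nonneg[of u v] by force
qed

theorem theorem4p1:
  fixes X :: "'a set" and d :: "'a \<Rightarrow> 'a \<Rightarrow> real" and S :: "'a rel" and T :: "'a \<Rightarrow> 'a"
  assumes "X \<noteq> {}" and "Metric_space X d"
    and "S \<subseteq> X \<times> X" and "refl_on X S" and "sym_on X S"
    and "T \<in> X \<rightarrow> X"
    and "\<exists>c. 0 < c \<and> c < 1 \<and> rel_contractive X d S c T"
    and "rel_complete X d S" and "almost_selfclosed X d S"
    and "rel_increasing X S T" and "semi_progressive X (chain_cover X S) T"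
  shows "global_strongly_Picard X d (chain_cover X S) T"
proof -
  interpret Metric_space X d by fact
  note T = \<open>T \<in> X \<rightarrow> X\<close> and inc = \<open>rel_increasing X S T\<close>
  obtain c where c: "0 < c" "c < 1" "rel_contractive X d S c T"
    using assms by blast
  show ?thesis
    unfolding global_strongly_Picard_def
  proof (intro conjI ballI impI)
    fix x assume "x \<in> progressive_points X T (chain_cover X S)"
    hence "(x, T x) \<in> chain_cover X S" by (simp add: progressive_points_def)
    then obtain p y where p: "p > 0" and y: "rel_ascending X S y" "\<And>j. y (j + p) = T (y j)"
      and orbit: "\<And>n. y (n * p) = (T ^^ n) x"
      using chain_unrolling[OF T inc] by metis
    obtain l where l: "limitin mtopology y l sequentially" "l \<in> Fix X T"
      using shift_orbit_limit_fixed[OF T c(3,2) \<open>rel_complete X d S\<close> \<open>almost_selfclosed X d S\<close> y]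
      by blast
    have "limitin mtopology (y \<circ> (\<lambda>n. n * p)) l sequentially"
      by (rule limitin_subsequence[OF _ l(1)]) (use p in \<open>simp add: strict_mono_def\<close>)
    thus "\<exists>l. d_converges X d (\<lambda>n. (T ^^ n) x) l \<and> l \<in> Fix X T"
      using l(2) by (auto simp: o_def orbit)
  next
    fix u v assume "u \<in> Fix X T" "v \<in> Fix X T" "(u, v) \<in> chain_cover X S"
    thus "u = v"
      using chain_connected_fixpoints_eq[OF T inc c(3)] c by simp
  qed
qed

end
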